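(* Let $\Bbbk$ be an algebraically closed field of characteristic zero, let $h\in\Bbbk[x]\setminus\Bbbk$ be square-free, and let $A_h=\Bbbk[x][t;h(x)\partial_x]$. (1) If $\deg h\ge 2$, then a derivation $D\in\mathrm{Der}(A_h)$ is locally finite if and only if $D=D_{g(x)}$ for some $g(x)\in\Bbbk[x]$. In particular, a derivation of $A_h$ is locally finite if and only if it is locally nilpotent. (2) If $\deg h=1$, then a derivation $D\in\mathrm{Der}(A_h)$ is locally finite if and only if $D=\lambda\,\mathrm{ad}_t+D_{g(x)}$ for some $\lambda\in\Bbbk$ and $g(x)\in\Bbbk[x]$.
   Context: $A_h=\Bbbk[x][t;h(x)\partial_x]$ is the differential Ore extension, i.e. the associative unital $\Bbbk$-algebra generated by $x,t$ subject to the relation $tx-xt=h(x)$. $\mathrm{Der}(A_h)$ is the set of $\Bbbk$-linear derivations of $A_h$. Square-free means $\gcd(h,h')=1$. For $g(x)\in\Bbbk[x]$, $D_{g(x)}$ is the derivation of $A_h$ determined by $D_{g(x)}(x)=0$ and $D_{g(x)}(t)=g(x)$. $\mathrm{ad}_t$ is the inner derivation $\mathrm{ad}_t(b)=tb-bt$. A derivation $D$ of a $\Bbbk$-algebra $A$ is locally finite if for every $a\in A$ the space $\mathrm{Span}_\Bbbk\{D^n(a)\mid n\ge0\}$ is finite-dimensional, and locally nilpotent if for every $a\in A$ there is $n\ge1$ with $D^n(a)=0$. *)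

theory Defs
  imports "HOL-Computational_Algebra.Polynomial"
begin

section \<open>Derivations of algebras given by explicit operations\<close>

text \<open>
  The algebra \<open>A\<^sub>h\<close> depends on the polynomial \<open>h\<close>, so its multiplication cannot be a type class
  operation. Scalar multiplication and product are therefore passed as arguments.
\<close>

definition k_derivation ::
    "('k::field \<Rightarrow> 'a::ab_group_add \<Rightarrow> 'a) \<Rightarrow> ('a \<Rightarrow> 'a \<Rightarrow> 'a) \<Rightarrow> ('a \<Rightarrow> 'a) \<Rightarrow> bool"
  where "k_derivation scale mul D \<longleftrightarrow>
    Vector_Spaces.linear scale scale D \<and> (\<forall>a b. D (mul a b) = mul (D a) b + mul a (D b))"

definition inner_derivation :: "('a \<Rightarrow> 'a \<Rightarrow> 'a::ab_group_add) \<Rightarrow> 'a \<Rightarrow> 'a \<Rightarrow> 'a"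
  where "inner_derivation mul a b = mul a b - mul b a"

text \<open>A subspace is finite-dimensional if it is spanned by a finite set.\<close>

definition locally_finite :: "('k::field \<Rightarrow> 'a::ab_group_add \<Rightarrow> 'a) \<Rightarrow> ('a \<Rightarrow> 'a) \<Rightarrow> bool"
  where "locally_finite scale D \<longleftrightarrow>
    (\<forall>a. \<exists>B. finite B \<and> module.span scale {(D ^^ n) a |n. True} = module.span scale B)"

definition locally_nilpotent :: "('a \<Rightarrow> 'a::zero) \<Rightarrow> bool"
  where "locally_nilpotent D \<longleftrightarrow> (\<forall>a. \<exists>n\<ge>1. (D ^^ n) a = 0)"


section \<open>The differential Ore extension \<open>A\<^sub>h\<close>\<close>

text \<open>
  As a left \<open>\<k>[x]\<close>-module, \<open>A\<^sub>h\<close> is free with basis \<open>1, t, t\<^sup>2, \<dots>\<close>. The element \<open>\<Sum>i. f\<^sub>i(x) t\<^sup>i\<close>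
  (coefficients on the left) is represented by the \<open>'k poly poly\<close> whose \<open>i\<close>-th coefficient
  is \<open>f\<^sub>i\<close>. Addition is that of \<open>'k poly poly\<close>, the product is not.

  From \<open>t f = f t + h f'\<close> one gets \<open>t (\<Sum>i. f\<^sub>i t\<^sup>i) = \<Sum>i. f\<^sub>i t\<^sup>i\<^sup>+\<^sup>1 + \<Sum>i. h f\<^sub>i' t\<^sup>i\<close>, which is
  \<open>ore_tmult\<close>, and \<open>(\<Sum>i. f\<^sub>i t\<^sup>i) q = \<Sum>i. f\<^sub>i (t\<^sup>i q)\<close>, which is \<open>ore_mult\<close>.
\<close>

definition ore_scale :: "'k::field \<Rightarrow> 'k poly poly \<Rightarrow> 'k poly poly"
  where "ore_scale c p = smult [:c:] p"

definition ore_tmult :: "'k::field poly \<Rightarrow> 'k poly poly \<Rightarrow> 'k poly poly"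
  where "ore_tmult h p = pCons 0 p + map_poly (\<lambda>f. h * pderiv f) p"

definition ore_mult :: "'k::field poly \<Rightarrow> 'k poly poly \<Rightarrow> 'k poly poly \<Rightarrow> 'k poly poly"
  where "ore_mult h p q = (\<Sum>i\<le>degree p. smult (coeff p i) ((ore_tmult h ^^ i) q))"

definition ore_x :: "'k::field poly poly"
  where "ore_x = [:[:0, 1:]:]"

definition ore_t :: "'k::field poly poly"
  where "ore_t = [:0, 1:]"

abbreviation ore_derivation :: "'k::field poly \<Rightarrow> ('k poly poly \<Rightarrow> 'k poly poly) \<Rightarrow> bool"
  where "ore_derivation h \<equiv> k_derivation ore_scale (ore_mult h)"

text \<open>Existence and uniqueness of this derivation are shown in \<open>ore_D_ex1\<close> below.\<close>

definition ore_D :: "'k::field poly \<Rightarrow> 'k poly \<Rightarrow> 'k poly poly \<Rightarrow> 'k poly poly"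
  where "ore_D h g = (THE D. ore_derivation h D \<and> D ore_x = 0 \<and> D ore_t = [:g:])"


subsection \<open>\<open>A\<^sub>h\<close> is an associative unital algebra\<close>

lemma vector_space_ore_scale: "vector_space ore_scale"
proof
  fix a b :: 'a and p q :: "'a poly poly"
  show "ore_scale (a + b) p = ore_scale a p + ore_scale b p"
    by (simp add: ore_scale_def flip: smult_add_left)
qed (simp_all add: ore_scale_def smult_add_right mult.commute flip: one_pCons)

lemma ore_tmult_0 [simp]: "ore_tmult h 0 = 0"
  by (simp add: ore_tmult_def)

lemma ore_tmult_add: "ore_tmult h (p + q) = ore_tmult h p + ore_tmult h q"
  by (rule poly_eqI)
    (simp add: ore_tmult_def coeff_map_poly coeff_pCons pderiv_add algebra_simps split: nat.split)

lemma ore_tmult_smult: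
  "ore_tmult h (smult f p) = smult f (ore_tmult h p) + smult (h * pderiv f) p"
  by (rule poly_eqI)
    (simp add: ore_tmult_def coeff_map_poly coeff_pCons pderiv_mult algebra_simps split: nat.split)

lemma ore_tmult_pCons:
  "ore_tmult h (pCons f p) = pCons (h * pderiv f) ([:f:] + ore_tmult h p)"
  by (rule poly_eqI)
    (simp add: ore_tmult_def coeff_map_poly coeff_pCons split: nat.split)

lemma ore_mult_0_left [simp]: "ore_mult h 0 q = 0"
  by (simp add: ore_mult_def)

lemma ore_mult_pCons:
  "ore_mult h (pCons f p) q = smult f q + ore_mult h p (ore_tmult h q)"
proof (cases "p = 0")
  case False
  then have "ore_mult h (pCons f p) q =
      (\<Sum>i\<le>Suc (degree p). smult (coeff (pCons f p) i) ((ore_tmult h ^^ i) q))"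
    by (simp add: ore_mult_def)
  also have "\<dots> = smult f q + (\<Sum>i\<le>degree p. smult (coeff p i) ((ore_tmult h ^^ Suc i) q))"
    by (subst sum.atMost_Suc_shift) simp
  finally show ?thesis
    by (simp add: ore_mult_def funpow_swap1)
qed (simp add: ore_mult_def)

lemma ore_mult_add_left: "ore_mult h (p + p') q = ore_mult h p q + ore_mult h p' q"
  by (induction p p' arbitrary: q rule: poly_induct2)
    (simp_all add: ore_mult_pCons smult_add_left)

lemma ore_mult_smult_left: "ore_mult h (smult f p) q = smult f (ore_mult h p q)"
  by (induction p arbitrary: q) (simp_all add: ore_mult_pCons smult_add_right)

lemma ore_mult_add_right: "ore_mult h p (q + q') = ore_mult h p q + ore_mult h p q'"
  by (induction p arbitrary: q q')
    (simp_all add: ore_mult_pCons ore_tmult_add smult_add_right)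

lemma ore_mult_scale_left: "ore_mult h (ore_scale c p) q = ore_scale c (ore_mult h p q)"
  by (simp add: ore_scale_def ore_mult_smult_left)

lemma ore_mult_scale_right: "ore_mult h p (ore_scale c q) = ore_scale c (ore_mult h p q)"
  by (induction p arbitrary: q)
    (simp_all add: ore_scale_def ore_mult_pCons ore_tmult_smult smult_add_right
      mult.commute pderiv_pCons)

lemma ore_mult_1_left: "ore_mult h 1 q = q"
  by (simp add: ore_mult_def)

lemma ore_mult_tmult_left: "ore_mult h (ore_tmult h p) q = ore_tmult h (ore_mult h p q)"
proof (induction p arbitrary: q)
  case (pCons f p)
  show ?case
    by (simp add: ore_tmult_pCons ore_mult_pCons ore_mult_add_left pCons.IH
        ore_tmult_add ore_tmult_smult algebra_simps)
qed simp

lemma ore_mult_assoc: "ore_mult h (ore_mult h p q) r = ore_mult h p (ore_mult h q r)"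
  by (induction p arbitrary: q)
    (simp_all add: ore_mult_pCons ore_mult_add_left ore_mult_smult_left ore_mult_tmult_left)

lemma ore_mult_const_left: "ore_mult h [:f:] q = smult f q"
  by (simp add: ore_mult_pCons)

lemma ore_mult_t_left: "ore_mult h ore_t q = ore_tmult h q"
  by (simp add: ore_t_def ore_mult_pCons)

lemma ore_mult_pCons_0_right: "ore_mult h p (pCons 0 q) = pCons 0 (ore_mult h p q)"
proof (induction p arbitrary: q)
  case (pCons f p)
  have "ore_tmult h (pCons 0 q) = pCons 0 (ore_tmult h q)"
    by (simp add: ore_tmult_pCons)
  then show ?case
    by (simp add: ore_mult_pCons pCons.IH)
qed simp

lemma ore_mult_1_right: "ore_mult h p 1 = p"
proof (induction p)
  case (pCons f p)
  have "ore_tmult h 1 = pCons 0 1"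
    by (simp add: ore_tmult_def map_poly_1 pderiv_1)
  then show ?case
    by (simp add: ore_mult_pCons ore_mult_pCons_0_right pCons.IH)
qed simp

lemma ore_mult_t_right: "ore_mult h p ore_t = pCons 0 p"
  by (simp add: ore_t_def ore_mult_pCons_0_right ore_mult_1_right flip: one_pCons)

lemma ore_relation: "ore_mult h ore_t ore_x - ore_mult h ore_x ore_t = [:h:]"
  unfolding ore_mult_t_left ore_mult_t_right
  by (simp add: ore_tmult_def ore_x_def map_poly_pCons pderiv_pCons)


subsection \<open>\<open>A\<^sub>h\<close> has the universal property of the presentation by \<open>x, t\<close> and \<open>t x - x t = h(x)\<close>\<close>

theorem ore_universal:
  fixes scale :: "'k::field \<Rightarrow> 'b::ring_1 \<Rightarrow> 'b" and h :: "'k poly"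
  assumes vs: "vector_space scale"
    and scale_left: "\<And>c a b. scale c a * b = scale c (a * b)"
    and scale_right: "\<And>c a b. a * scale c b = scale c (a * b)"
    and rel: "T * X - X * T = (\<Sum>i\<le>degree h. scale (coeff h i) (X ^ i))"
  shows "\<exists>!\<phi>. Vector_Spaces.linear ore_scale scale \<phi> \<and>
           (\<forall>p q. \<phi> (ore_mult h p q) = \<phi> p * \<phi> q) \<and> \<phi> 1 = 1 \<and> \<phi> ore_x = X \<and> \<phi> ore_t = T"
proof -
  interpret vector_space scale by (rule vs)
  define ev where "ev f = (\<Sum>i\<le>degree f. scale (coeff f i) (X ^ i))" for f
  define \<Phi> where "\<Phi> p = (\<Sum>i\<le>degree p. ev (coeff p i) * T ^ i)" for p
  have ev_0 [simp]: "ev 0 = 0"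
    by (simp add: ev_def)
  have ev_pCons: "ev (pCons c f) = scale c 1 + X * ev f" for c f
  proof (cases "f = 0")
    case False
    then have "ev (pCons c f) = (\<Sum>i\<le>Suc (degree f). scale (coeff (pCons c f) i) (X ^ i))"
      by (simp add: ev_def)
    also have "\<dots> = scale c 1 + (\<Sum>i\<le>degree f. scale (coeff f i) (X ^ Suc i))"
      by (subst sum.atMost_Suc_shift) simp
    finally show ?thesis
      by (simp add: ev_def sum_distrib_left scale_right)
  qed (simp add: ev_def)
  have ev_add: "ev (f + g) = ev f + ev g" for f g
    by (induction f g rule: poly_induct2) (simp_all add: ev_pCons scale_left_distrib algebra_simps)
  have ev_smult: "ev (smult c f) = scale c (ev f)" for c f
    by (induction f) (simp_all add: ev_pCons scale_right scale_right_distrib)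
  have ev_X: "ev f * X = X * ev f" for f
    by (induction f) (simp_all add: ev_pCons scale_right scale_left algebra_simps)
  have ev_mult: "ev (f * g) = ev f * ev g" for f g
    by (induction f) (simp_all add: ev_pCons ev_add ev_smult scale_left algebra_simps)
  have ev_comm: "ev f * ev g = ev g * ev f" for f g
    by (simp add: mult.commute flip: ev_mult)
  have TX: "T * X = X * T + ev h"
    using rel by (simp add: ev_def algebra_simps)
  have T_ev: "T * ev f = ev f * T + ev (h * pderiv f)" for f
  proof (induction f)
    case (pCons c f)
    have "T * ev (pCons c f) = scale c T + (T * X) * ev f"
      by (simp add: ev_pCons algebra_simps scale_right)
    also have "\<dots> = scale c T + X * (T * ev f) + ev h * ev f"
      by (simp add: TX algebra_simps)
    also have "\<dots> = scale c T + X * ev f * T + X * (ev h * ev (pderiv f)) + ev f * ev h"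
      by (simp add: pCons.IH ev_mult ev_comm[of h f] algebra_simps)
    also have "\<dots> = ev (pCons c f) * T + ev (h * pderiv (pCons c f))"
      by (simp add: ev_pCons pderiv_pCons ev_mult ev_add scale_left algebra_simps)
    finally show ?case .
  qed simp
  have \<Phi>_0 [simp]: "\<Phi> 0 = 0"
    by (simp add: \<Phi>_def)
  have \<Phi>_pCons: "\<Phi> (pCons f p) = ev f + \<Phi> p * T" for f p
  proof (cases "p = 0")
    case False
    then have "\<Phi> (pCons f p) = (\<Sum>i\<le>Suc (degree p). ev (coeff (pCons f p) i) * T ^ i)"
      by (simp add: \<Phi>_def)
    also have "\<dots> = ev f + (\<Sum>i\<le>degree p. ev (coeff p i) * T ^ Suc i)"
      by (subst sum.atMost_Suc_shift) simp
    finally show ?thesis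
      by (simp add: \<Phi>_def sum_distrib_right power_commutes mult.assoc)
  qed (simp add: \<Phi>_def)
  have \<Phi>_add: "\<Phi> (p + q) = \<Phi> p + \<Phi> q" for p q
    by (induction p q rule: poly_induct2) (simp_all add: \<Phi>_pCons ev_add algebra_simps)
  have \<Phi>_smult: "\<Phi> (smult f p) = ev f * \<Phi> p" for f p
    by (induction p) (simp_all add: \<Phi>_pCons ev_mult ev_comm[of _ f] algebra_simps)
  have \<Phi>_scale: "\<Phi> (ore_scale c p) = scale c (\<Phi> p)" for c p
    by (simp add: ore_scale_def \<Phi>_smult ev_pCons scale_left)
  have \<Phi>_tmult: "\<Phi> (ore_tmult h p) = T * \<Phi> p" for p
  proof (induction p)
    case (pCons f p)
    show ?case
      by (simp add: ore_tmult_pCons \<Phi>_pCons \<Phi>_add pCons.IH T_ev algebra_simps)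
  qed simp
  have \<Phi>_mult: "\<Phi> (ore_mult h p q) = \<Phi> p * \<Phi> q" for p q
    by (induction p arbitrary: q)
      (simp_all add: ore_mult_pCons \<Phi>_add \<Phi>_smult \<Phi>_pCons \<Phi>_tmult algebra_simps)
  have ev_1: "ev 1 = 1"
    by (simp add: one_pCons ev_pCons)
  have \<Phi>_lin: "Vector_Spaces.linear ore_scale scale \<Phi>"
    using vector_space_ore_scale vs
    by (auto intro!: Vector_Spaces.linear.intro module_hom.intro module_hom_axioms.intro
        \<Phi>_add \<Phi>_scale simp: module_iff_vector_space)
  show ?thesis
  proof (rule ex1I[of _ \<Phi>])
    show "Vector_Spaces.linear ore_scale scale \<Phi> \<and>
        (\<forall>p q. \<Phi> (ore_mult h p q) = \<Phi> p * \<Phi> q) \<and> \<Phi> 1 = 1 \<and> \<Phi> ore_x = X \<and> \<Phi> ore_t = T"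
      using \<Phi>_lin \<Phi>_mult
      by (simp add: one_pCons ore_x_def ore_t_def \<Phi>_pCons ev_pCons)
  next
    fix \<psi>
    assume \<psi>: "Vector_Spaces.linear ore_scale scale \<psi> \<and>
        (\<forall>p q. \<psi> (ore_mult h p q) = \<psi> p * \<psi> q) \<and> \<psi> 1 = 1 \<and> \<psi> ore_x = X \<and> \<psi> ore_t = T"
    then interpret \<psi>: Vector_Spaces.linear ore_scale scale \<psi> by simp
    have \<psi>_const: "\<psi> [:f:] = ev f" for f
    proof (induction f)
      case (pCons c f)
      have "[:pCons c f:] = ore_scale c 1 + ore_mult h ore_x [:f:]"
        by (simp add: ore_scale_def ore_x_def ore_mult_const_left)
      then show ?case
        using \<psi> by (simp add: \<psi>.add \<psi>.scale ev_pCons pCons.IH)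
    qed (simp add: \<psi>.zero)
    have "\<psi> p = \<Phi> p" for p
    proof (induction p)
      case (pCons f p)
      have "\<psi> (pCons f p) = \<psi> ([:f:] + ore_mult h p ore_t)"
        by (simp add: ore_mult_t_right)
      with \<psi> show ?case
        by (simp only: \<psi>.add \<psi>_const \<Phi>_pCons pCons.IH)
    qed (simp add: \<psi>.zero)
    then show "\<psi> = \<Phi>" ..
  qed
qed


subsection \<open>\<open>D\<^sub>g\<close> is well defined\<close>

lemma ore_derivation_eqI:
  assumes D: "ore_derivation h D" and E: "ore_derivation h E"
    and x: "D ore_x = E ore_x" and t: "D ore_t = E ore_t"
  shows "D = E"
proof
  interpret D: Vector_Spaces.linear ore_scale ore_scale D
    using D by (simp add: k_derivation_def)
  interpret E: Vector_Spaces.linear ore_scale ore_scale E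
    using E by (simp add: k_derivation_def)
  have Dm: "D (ore_mult h p q) = ore_mult h (D p) q + ore_mult h p (D q)" for p q
    using D by (simp add: k_derivation_def)
  have Em: "E (ore_mult h p q) = ore_mult h (E p) q + ore_mult h p (E q)" for p q
    using E by (simp add: k_derivation_def)
  have one: "D 1 = 0" "E 1 = 0"
    using Dm[of 1 1] Em[of 1 1]
    by (simp_all only: ore_mult_1_left ore_mult_1_right add_cancel_right_right)
  have const: "D [:f:] = E [:f:]" for f
  proof (induction f)
    case (pCons c f)
    have "[:pCons c f:] = ore_scale c 1 + ore_mult h ore_x [:f:]"
      by (simp add: ore_scale_def ore_x_def ore_mult_const_left)
    then show ?case
      by (simp add: D.add D.scale E.add E.scale one Dm Em x pCons.IH)
  qed (simp add: D.zero E.zero)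
  fix p show "D p = E p"
  proof (induction p)
    case (pCons f p)
    have "pCons f p = [:f:] + ore_mult h p ore_t"
      by (simp add: ore_mult_t_right)
    then show ?case
      by (simp add: D.add E.add const Dm Em t pCons.IH)
  qed (simp add: D.zero E.zero)
qed

lemma ore_D_ex1: "\<exists>!D. ore_derivation h D \<and> D ore_x = 0 \<and> D ore_t = [:g:]"
proof -
  define e where "e = rec_nat 0 (\<lambda>n r. [:0, 1:] * r + (ore_tmult h ^^ n) [:g:])"
  define E where "E p = (\<Sum>i\<le>degree p. smult (coeff p i) (e i))" for p
  have e_0 [simp]: "e 0 = 0" and e_Suc: "e (Suc n) = [:0, 1:] * e n + (ore_tmult h ^^ n) [:g:]" for n
    by (simp_all add: e_def)
  have E_0 [simp]: "E 0 = 0"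
    by (simp add: E_def)
  have E_pCons: "E (pCons f p) = pCons 0 (E p) + ore_mult h p [:g:]" for f p
  proof (cases "p = 0")
    case False
    then have "E (pCons f p) = (\<Sum>i\<le>Suc (degree p). smult (coeff (pCons f p) i) (e i))"
      by (simp add: E_def)
    also have "\<dots> = (\<Sum>i\<le>degree p. smult (coeff p i) (e (Suc i)))"
      by (subst sum.atMost_Suc_shift) simp
    also have "\<dots> = (\<Sum>i\<le>degree p. [:0, 1:] * smult (coeff p i) (e i)) + ore_mult h p [:g:]"
      by (simp only: e_Suc smult_add_right sum.distrib ore_mult_def mult_smult_right)
    also have "\<dots> = [:0, 1:] * E p + ore_mult h p [:g:]"
      by (simp only: E_def sum_distrib_left)
    finally show ?thesis
      by simp
  qed (simp add: E_def)
  have E_add: "E (p + q) = E p + E q" for p q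
    by (induction p q rule: poly_induct2) (simp_all add: E_pCons ore_mult_add_left)
  have E_smult: "E (smult f p) = smult f (E p)" for f p
    by (induction p) (simp_all add: E_pCons ore_mult_smult_left smult_add_right)
  have E_tmult: "E (ore_tmult h p) = smult g p + ore_tmult h (E p)" for p
  proof (induction p)
    case (pCons f p)
    show ?case
      by (simp add: ore_tmult_pCons E_pCons E_add pCons.IH ore_mult_add_left
          ore_mult_tmult_left ore_mult_const_left ore_tmult_add ore_mult_pCons mult.commute)
  qed simp
  have E_mult: "E (ore_mult h p q) = ore_mult h (E p) q + ore_mult h p (E q)" for p q
  proof (induction p arbitrary: q)
    case (pCons f p)
    have "ore_mult h (pCons 0 (E p)) q = ore_mult h (E p) (ore_tmult h q)"
      by (simp add: ore_mult_pCons)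
    moreover have "ore_mult h p (smult g q) = ore_mult h (ore_mult h p [:g:]) q"
      by (simp add: ore_mult_assoc ore_mult_const_left)
    ultimately show ?case
      by (simp add: ore_mult_pCons E_add E_smult E_pCons E_tmult pCons.IH
          ore_mult_add_left ore_mult_add_right)
  qed simp
  have "Vector_Spaces.linear ore_scale ore_scale E"
    using vector_space_ore_scale
    by (auto intro!: Vector_Spaces.linear.intro module_hom.intro module_hom_axioms.intro
        E_add simp: E_smult ore_scale_def[of _ "E _"] ore_scale_def module_iff_vector_space)
  then have "ore_derivation h E"
    by (simp add: k_derivation_def E_mult)
  moreover have "E ore_x = 0" "E ore_t = [:g:]"
    by (simp_all add: ore_x_def ore_t_def E_pCons ore_mult_const_left)
  ultimately show ?thesis
    by (intro ex1I[of _ E]) (auto intro: ore_derivation_eqI)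
qed

lemma ore_D:
  shows "ore_derivation h (ore_D h g)" and "ore_D h g ore_x = 0" and "ore_D h g ore_t = [:g:]"
  using theI'[OF ore_D_ex1[of h g]] by (auto simp: ore_D_def)

end

theory Submission
  imports Defs
begin

text \<open>
  The idea is to follow the orbit of \<open>x\<close> under a derivation \<open>D\<close> and to look only at top
  coefficients with respect to the degree in \<open>t\<close>. Suppose \<open>D x = A t\<^sup>m + \<dots>\<close> with \<open>A \<noteq> 0\<close>.
  Applying \<open>D\<close> to \<open>t x - x t = h\<close> shows \<open>D t = B t\<^sup>m\<^sup>+\<^sup>1 + \<dots>\<close>, where
  \<open>(m + 1) h B = A h' - h A'\<close> (\<open>coeff_derivation_t_top\<close>). Hence \<open>h\<close> divides \<open>A h'\<close>, and since
  \<open>h\<close> is square-free, \<open>A = h v\<close> for some \<open>v\<close>, and \<open>(m + 1) B = - h v'\<close>.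

  On top coefficients \<open>D\<close> therefore sends \<open>f t\<^sup>k\<close> to \<open>h (v f' - k v' f / (m + 1)) t\<^sup>k\<^sup>+\<^sup>m\<close>
  (\<open>coeff_derivation_top\<close>). Comparing degrees in \<open>x\<close>, and using characteristic zero, this does
  not vanish as long as \<open>(m + 1) deg f > k deg v\<close>. The inequality holds for \<open>x\<close>, where
  \<open>k = 0\<close> and \<open>deg f = 1\<close>, and persists under \<open>D\<close>. So each application of \<open>D\<close> to the orbit
  of \<open>x\<close> raises the degree in \<open>t\<close> by \<open>m\<close> and the degree of the top coefficient by
  \<open>deg h + deg v - 1\<close> (\<open>derivation_growth\<close>). If \<open>D\<close> is locally finite, both numbers are zero:
  \<open>m = 0\<close>, \<open>v\<close> is a constant \<open>c\<close> and \<open>deg h = 1\<close>, so \<open>D x = c h\<close>. The remaining possibility is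
  \<open>D x = 0\<close>. In both cases \<open>D t\<close> lies in \<open>\<k>[x]\<close>, and \<open>D = c ad\<^sub>t + D\<^sub>g\<close>, with \<open>c = 0\<close> unless
  \<open>deg h = 1\<close> (\<open>derivation_with_x_multiple_of_h\<close>).

  Conversely, \<open>D\<^sub>g\<close> is locally nilpotent since it lowers the degree in \<open>t\<close>. If \<open>deg h = 1\<close>, give
  \<open>x\<close> the weight \<open>1\<close> and \<open>t\<close> a positive weight that is at least \<open>deg g\<close>. Then \<open>c ad\<^sub>t + D\<^sub>g\<close>
  preserves the finite-dimensional spaces of elements of bounded weight
  (\<open>weight_filtration_derivation\<close>), so it is locally finite.
\<close>


section \<open>Polynomials over a field\<close>

lemma degree_smult_leI: "degree p \<le> n \<Longrightarrow> degree (smult f p) \<le> n"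
  using degree_smult_le order.trans by blast

lemma degree_map_poly_le: "degree (map_poly f p) \<le> degree p" if "f 0 = 0"
  using that by (intro degree_le) (simp add: coeff_map_poly coeff_eq_0)

text \<open>
  Euclid's lemma for polynomials over an arbitrary field, by Euclidean division.
\<close>

lemma poly_coprime_dvd_multD:
  fixes a b c :: "'k::field poly"
  assumes "coprime a b" and "a \<noteq> 0" and "a dvd c * b"
  shows "a dvd c"
proof -
  \<comment> \<open>The polynomials \<open>e\<close> with \<open>a dvd c * e\<close> form an ideal containing \<open>a\<close> and \<open>b\<close>;
    a nonzero element of least degree generates it.\<close>
  define P where "P d \<longleftrightarrow> d \<noteq> 0 \<and> a dvd c * d" for d
  define d where "d = arg_min degree P"
  have "P a"
    using assms by (simp add: P_def)
  then have d: "P d" and min: "\<And>e. P e \<Longrightarrow> degree d \<le> degree e"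
    unfolding d_def by (auto intro: arg_min_natI arg_min_nat_le)
  have dvd: "d dvd e" if "a dvd c * e" for e
  proof (rule ccontr)
    assume "\<not> d dvd e"
    then have ne: "e mod d \<noteq> 0"
      by (simp add: dvd_eq_mod_eq_0)
    have "c * (e mod d) = c * e - (c * d) * (e div d)"
      by (simp add: minus_div_mult_eq_mod[symmetric] algebra_simps)
    then have "a dvd c * (e mod d)"
      using that d by (simp add: P_def)
    then have "degree d \<le> degree (e mod d)"
      using ne by (intro min) (simp add: P_def)
    then show False
      using degree_mod_less[of d e] d ne by (simp add: P_def)
  qed
  have "is_unit d"
    using assms by (intro coprime_common_divisor[OF assms(1)] dvd) auto
  then show ?thesis
    using d by (simp add: P_def dvd_mult_unit_iff)
qed

text \<open>
  This expression is what a derivation makes of a top coefficient \<open>f\<close>, see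
  \<open>derivation_growth\<close>. For \<open>a = b = 1\<close> it is the Wronskian of \<open>v\<close> and \<open>f\<close>. Its two products
  can cancel in top degree only if the weighted degrees agree.
\<close>

lemma degree_weighted_wronskian:
  fixes v f :: "'k::field_char_0 poly"
  assumes "v \<noteq> 0" and "f \<noteq> 0" and less: "b * degree v < a * degree f"
  defines "w \<equiv> smult (of_nat a) (v * pderiv f) - smult (of_nat b) (pderiv v * f)"
  shows "w \<noteq> 0" and "degree w = degree v + degree f - 1"
proof -
  define p j where "p = degree v" and "j = degree f - 1"
  have f: "degree f = Suc j"
    using less by (cases "degree f") (auto simp: j_def)
  have "coeff (v * pderiv f) (p + j) = lead_coeff v * coeff (pderiv f) j"
    using coeff_mult_degree_sum[of v "pderiv f"] by (simp add: degree_pderiv f p_def)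
  then have 1: "coeff (v * pderiv f) (p + j) = of_nat (Suc j) * (lead_coeff v * lead_coeff f)"
    by (simp add: coeff_pderiv f)
  have 2: "coeff (pderiv v * f) (p + j) = of_nat p * (lead_coeff v * lead_coeff f)"
  proof (cases p)
    case 0
    then show ?thesis
      by (simp add: p_def pderiv_eq_0_iff[THEN iffD2])
  next
    case (Suc p')
    have "coeff (pderiv v * f) (p' + Suc j) = coeff (pderiv v) p' * lead_coeff f"
      using coeff_mult_degree_sum[of "pderiv v" f] Suc by (simp add: degree_pderiv f p_def)
    then show ?thesis
      using Suc by (simp add: coeff_pderiv p_def)
  qed
  \<comment> \<open>The two products contribute multiples of the same number to this coefficient, so it
    vanishes only if \<open>a deg f = b deg v\<close> in \<open>'k\<close>; characteristic zero excludes this.\<close>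
  have "coeff w (p + j) = (of_nat (a * Suc j) - of_nat (b * p)) * (lead_coeff v * lead_coeff f)"
    unfolding w_def coeff_diff coeff_smult 1 2 by (simp add: algebra_simps)
  moreover have "of_nat (a * Suc j) \<noteq> (of_nat (b * p) :: 'k)"
    using less unfolding of_nat_eq_iff f p_def by simp
  ultimately have c: "coeff w (p + j) \<noteq> 0"
    using assms(1,2) by simp
  then show "w \<noteq> 0"
    by auto
  have "degree (v * pderiv f) \<le> p + j"
    using degree_mult_le[of v "pderiv f"] by (simp add: degree_pderiv f p_def)
  moreover have "degree (pderiv v * f) \<le> p + j"
  proof (cases "pderiv v = 0")
    case False
    then have "p > 0"
      by (simp add: pderiv_eq_0_iff p_def)
    then show ?thesis
      using degree_mult_le[of "pderiv v" f] by (simp add: degree_pderiv f p_def)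
  qed simp
  ultimately have "degree w \<le> p + j"
    unfolding w_def by (intro degree_diff_le degree_smult_leI)
  with c show "degree w = degree v + degree f - 1"
    using le_degree[OF c] by (simp add: p_def f)
qed


section \<open>Derivations of the Ore extension\<close>

lemma derivation_add: "ore_derivation h D \<Longrightarrow> D (p + q) = D p + D q"
  unfolding k_derivation_def by (metis Vector_Spaces.linear.axioms(3) module_hom.add)

lemma derivation_scale: "ore_derivation h D \<Longrightarrow> D (ore_scale c p) = ore_scale c (D p)"
  unfolding k_derivation_def by (metis Vector_Spaces.linear.axioms(3) module_hom.scale)

lemma derivation_mult:
  "ore_derivation h D \<Longrightarrow> D (ore_mult h p q) = ore_mult h (D p) q + ore_mult h p (D q)"
  by (simp add: k_derivation_def)

lemma derivation_0: "ore_derivation h D \<Longrightarrow> D 0 = 0"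
  using derivation_add[of h D 0 0] by (metis add_0_left add_cancel_left_left)

lemma derivation_diff: "ore_derivation h D \<Longrightarrow> D (p - q) = D p - D q"
  using derivation_add[of h D "p - q" q] by (simp add: algebra_simps)

lemma derivation_1: "ore_derivation h D \<Longrightarrow> D 1 = 0"
  using derivation_mult[of h D 1 1]
  by (simp only: ore_mult_1_left ore_mult_1_right add_cancel_right_right)

text \<open>
  Together with \<open>derivation_pCons\<close> this computes a derivation from its values at \<open>x\<close> and \<open>t\<close>
  by recursion over the representation, along \<open>c + x f\<close> for coefficients and \<open>f + p t\<close> for
  elements.
\<close>

lemma derivation_const_pCons:
  assumes "ore_derivation h D"
  shows "D [:pCons c f:] = ore_mult h (D ore_x) [:f:] + smult [:0, 1:] (D [:f:])"
proof -
  have "[:pCons c f:] = ore_scale c 1 + ore_mult h ore_x [:f:]"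
    by (simp add: ore_scale_def ore_x_def ore_mult_const_left)
  moreover have "ore_mult h ore_x (D [:f:]) = smult [:0, 1:] (D [:f:])"
    by (simp add: ore_x_def ore_mult_const_left)
  ultimately show ?thesis
    using assms by (simp add: derivation_add derivation_scale derivation_1 derivation_mult)
        (simp add: ore_scale_def)
qed

lemma derivation_pCons:
  assumes "ore_derivation h D"
  shows "D (pCons f p) = D [:f:] + pCons 0 (D p) + ore_mult h p (D ore_t)"
proof -
  have "pCons f p = [:f:] + ore_mult h p ore_t"
    by (simp add: ore_mult_t_right)
  then show ?thesis
    using derivation_add[OF assms, of "[:f:]"] derivation_mult[OF assms, of p ore_t]
    by (simp only: ore_mult_t_right add.assoc)
qed

lemma derivation_const_0:
  "ore_derivation h D \<Longrightarrow> D ore_x = 0 \<Longrightarrow> D [:f:] = 0"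
  by (induction f) (simp_all add: derivation_const_pCons derivation_0)

lemma ore_derivationI:
  assumes "\<And>p q. D (p + q) = D p + D q"
    and "\<And>c p. D (ore_scale c p) = ore_scale c (D p)"
    and "\<And>p q. D (ore_mult h p q) = ore_mult h (D p) q + ore_mult h p (D q)"
  shows "ore_derivation h D"
  unfolding k_derivation_def using vector_space_ore_scale assms
  by (auto intro!: Vector_Spaces.linear.intro module_hom.intro module_hom_axioms.intro
      simp: module_iff_vector_space)

lemma ore_derivation_lincomb:
  assumes "ore_derivation h D" and "ore_derivation h E"
  shows "ore_derivation h (\<lambda>a. ore_scale c (D a) + E a)"
  by (rule ore_derivationI)
    (simp_all add: derivation_add[OF assms(1)] derivation_add[OF assms(2)]
      derivation_scale[OF assms(1)] derivation_scale[OF assms(2)]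
      derivation_mult[OF assms(1)] derivation_mult[OF assms(2)]
      ore_mult_add_left ore_mult_add_right ore_mult_scale_left ore_mult_scale_right,
     simp_all add: ore_scale_def smult_add_right algebra_simps)

lemma ore_mult_diff_left: "ore_mult h (p - q) r = ore_mult h p r - ore_mult h q r"
  using ore_mult_add_left[of h "p - q" q r] by (simp add: algebra_simps)

lemma ore_mult_diff_right: "ore_mult h p (q - r) = ore_mult h p q - ore_mult h p r"
  using ore_mult_add_right[of h p "q - r" r] by (simp add: algebra_simps)

lemma ore_derivation_inner: "ore_derivation h (inner_derivation (ore_mult h) a)"
proof (rule ore_derivationI)
  fix c p
  show "inner_derivation (ore_mult h) a (ore_scale c p) =
      ore_scale c (inner_derivation (ore_mult h) a p)"
    unfolding inner_derivation_def ore_mult_scale_left ore_mult_scale_right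
    by (simp add: ore_scale_def smult_diff_right)
qed (simp_all add: inner_derivation_def ore_mult_add_left ore_mult_add_right
    ore_mult_diff_left ore_mult_diff_right ore_mult_assoc)

lemma inner_derivation_self: "inner_derivation mul a a = 0"
  by (simp add: inner_derivation_def)

lemma inner_derivation_t:
  "inner_derivation (ore_mult h) ore_t p = map_poly (\<lambda>f. h * pderiv f) p"
  by (simp add: inner_derivation_def ore_mult_t_left ore_mult_t_right ore_tmult_def)

lemma inner_derivation_t_x: "inner_derivation (ore_mult h) ore_t ore_x = [:h:]"
  using ore_relation[of h] by (simp add: inner_derivation_def)

lemma inner_derivation_x_t: "inner_derivation (ore_mult h) ore_x ore_t = [:- h:]"
  using arg_cong[OF ore_relation[of h], of uminus] by (simp add: inner_derivation_def)


section \<open>Top coefficients with respect to the degree in \<open>t\<close>\<close>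

lemma degree_ore_tmult_le: "degree (ore_tmult h p) \<le> Suc (degree p)"
  unfolding ore_tmult_def
  by (rule degree_add_le) (auto intro!: order.trans[OF degree_map_poly_le] simp: degree_pCons_eq_if)

lemma coeff_ore_tmult_Suc:
  "degree p \<le> n \<Longrightarrow> coeff (ore_tmult h p) (Suc n) = coeff p n"
  by (simp add: ore_tmult_def coeff_map_poly coeff_eq_0)

text \<open>
  Modulo lower degree in \<open>t\<close> the product is that of the commutative ring \<open>\<k>[x][t]\<close>: the
  correction term in \<open>t f = f t + h f'\<close> has smaller degree.
\<close>

lemma coeff_ore_mult_top:
  assumes "degree p \<le> n" and "degree q \<le> k"
  shows "degree (ore_mult h p q) \<le> n + k \<and> coeff (ore_mult h p q) (n + k) = coeff p n * coeff q k"
  using assms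
proof (induction p arbitrary: n q k)
  case (pCons f p)
  show ?case
  proof (cases "p = 0")
    case True
    then show ?thesis
      using pCons.prems
      by (cases n) (auto simp: ore_mult_const_left coeff_eq_0 intro: order.trans[OF degree_smult_le])
  next
    case False
    then obtain n' where n: "n = Suc n'" and n': "degree p \<le> n'"
      using pCons.prems by (cases n) auto
    have "degree (ore_tmult h q) \<le> Suc k"
      using degree_ore_tmult_le[of h q] pCons.prems by linarith
    from pCons.IH[OF n' this] show ?thesis
      using pCons.prems coeff_ore_tmult_Suc[of q k h]
      by (auto simp: ore_mult_pCons n coeff_eq_0
          intro!: degree_add_le intro: order.trans[OF degree_smult_le])
  qed
qed simp

lemma coeff_derivation_const_top:
  assumes D: "ore_derivation h D" and x: "degree (D ore_x) \<le> m"
  shows "degree (D [:f:]) \<le> m \<and> coeff (D [:f:]) m = coeff (D ore_x) m * pderiv f"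
proof (induction f)
  case (pCons c f)
  have "degree (ore_mult h (D ore_x) [:f:]) \<le> m"
    "coeff (ore_mult h (D ore_x) [:f:]) m = coeff (D ore_x) m * f"
    using coeff_ore_mult_top[OF x, of "[:f:]" 0 h] by simp_all
  then show ?case
    using pCons.IH unfolding derivation_const_pCons[OF D]
    by (auto simp: pderiv_pCons algebra_simps intro!: degree_add_le degree_smult_leI)
qed (simp add: derivation_0[OF D])

text \<open>
  On the associated graded ring \<open>\<k>[x][t]\<close> a derivation with \<open>x \<mapsto> A t\<^sup>m + \<dots>\<close> and
  \<open>t \<mapsto> B t\<^sup>m\<^sup>+\<^sup>1 + \<dots>\<close> acts as the vector field \<open>A t\<^sup>m \<partial>\<^sub>x + B t\<^sup>m\<^sup>+\<^sup>1 \<partial>\<^sub>t\<close>, which sends \<open>f t\<^sup>k\<close> to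
  \<open>(A f' + k B f) t\<^sup>k\<^sup>+\<^sup>m\<close>.
\<close>

lemma coeff_derivation_top:
  assumes D: "ore_derivation h D" and x: "degree (D ore_x) \<le> m" and t: "degree (D ore_t) \<le> Suc m"
    and p: "degree p \<le> k"
  shows "degree (D p) \<le> k + m \<and>
    coeff (D p) (k + m) =
      coeff (D ore_x) m * pderiv (coeff p k) + of_nat k * coeff (D ore_t) (Suc m) * coeff p k"
  using p
proof (induction k arbitrary: p)
  case 0
  then obtain f where "p = [:f:]"
    using degree_eq_zeroE by auto
  then show ?case
    using coeff_derivation_const_top[OF D x] by simp
next
  case (Suc k)
  obtain f q where pq: "p = pCons f q"
    by (cases p)
  with Suc.prems have q: "degree q \<le> k"
    by (cases "q = 0") auto
  have f: "degree (D [:f:]) \<le> m"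
    using coeff_derivation_const_top[OF D x] by simp
  have "degree (pCons 0 (D q)) \<le> Suc (k + m)"
    using Suc.IH[OF q] by (simp add: degree_pCons_eq_if)
  then show ?case
    using Suc.IH[OF q] coeff_ore_mult_top[OF q t, of h] f unfolding pq derivation_pCons[OF D, of f q]
    by (auto simp: coeff_eq_0 algebra_simps intro!: degree_add_le)
qed

text \<open>
  A derivation of this kind lowers the degree in \<open>t\<close>, acting as \<open>g \<partial>\<^sub>t\<close> on top coefficients.
  It is needed twice: for \<open>D\<^sub>g\<close> itself, and for the inner derivation of \<open>x\<close>, where \<open>g = - h\<close>.
\<close>

lemma coeff_x_killing_derivation_top:
  assumes D: "ore_derivation h D" and x: "D ore_x = 0" and t: "D ore_t = [:g:]"
    and p: "degree p \<le> Suc k"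
  shows "degree (D p) \<le> k \<and> coeff (D p) k = of_nat (Suc k) * g * coeff p (Suc k)"
  using p
proof (induction k arbitrary: p)
  case 0
  obtain f q where pq: "p = pCons f q"
    by (cases p)
  with 0 have "degree q = 0"
    by (cases "q = 0") auto
  then obtain b where "q = [:b:]"
    using degree_eq_zeroE by auto
  then show ?case
    by (simp add: pq derivation_pCons[OF D, of f "[:b:]"] derivation_const_0[OF D x] t ore_mult_const_left)
next
  case (Suc k)
  obtain f q where pq: "p = pCons f q"
    by (cases p)
  with Suc.prems have q: "degree q \<le> Suc k"
    by (cases "q = 0") auto
  have "degree (pCons 0 (D q)) \<le> Suc k"
    using Suc.IH[OF q] by (simp add: degree_pCons_eq_if)
  then show ?case
    using Suc.IH[OF q] coeff_ore_mult_top[OF q, of "[:g:]" 0 h]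
    unfolding pq derivation_pCons[OF D, of f q] derivation_const_0[OF D x] t
    by (auto simp: algebra_simps intro!: degree_add_le)
qed


section \<open>Consequences of the defining relation\<close>

text \<open>
  The derivation is applied to both sides of \<open>t x - x t = h\<close>; the values at \<open>x\<close> and \<open>t\<close> have to
  be compatible in this way.
\<close>

lemma derivation_relation:
  assumes "ore_derivation h D"
  shows "inner_derivation (ore_mult h) ore_x (D ore_t) =
    map_poly (\<lambda>f. h * pderiv f) (D ore_x) - D [:h:]"
proof -
  have "D (ore_mult h ore_t ore_x - ore_mult h ore_x ore_t) = D [:h:]"
    by (simp only: ore_relation)
  then have "inner_derivation (ore_mult h) ore_x (D ore_t) =
      inner_derivation (ore_mult h) ore_t (D ore_x) - D [:h:]"
    by (simp add: derivation_diff[OF assms] derivation_mult[OF assms] inner_derivation_def algebra_simps)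
  then show ?thesis
    by (simp add: inner_derivation_t)
qed

text \<open>
  The relation bounds the degree of \<open>D t\<close> in \<open>t\<close> and ties its top coefficient to that of \<open>D x\<close>.
  Since \<open>m\<close> is only an upper bound, the case \<open>D x = 0\<close> is included.
\<close>

lemma coeff_derivation_t_top:
  fixes h :: "'k::field_char_0 poly"
  assumes D: "ore_derivation h D" and h: "h \<noteq> 0" and x: "degree (D ore_x) \<le> m"
  defines "A \<equiv> coeff (D ore_x) m"
  shows "degree (D ore_t) \<le> Suc m"
    and "of_nat (Suc m) * h * coeff (D ore_t) (Suc m) = A * pderiv h - h * pderiv A"
proof -
  \<comment> \<open>The inner derivation of \<open>x\<close> lowers the degree in \<open>t\<close> by exactly one, so its value at
    \<open>D t\<close>, known from the relation, gives back the degree and the top coefficient of \<open>D t\<close>.\<close>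
  let ?R = "inner_derivation (ore_mult h) ore_x"
  note R = coeff_x_killing_derivation_top
    [OF ore_derivation_inner inner_derivation_self inner_derivation_x_t, of _ _ h]
  have "degree (map_poly (\<lambda>f. h * pderiv f) (D ore_x)) \<le> m"
    using x by (auto intro!: order.trans[OF degree_map_poly_le])
  then have deg: "degree (?R (D ore_t)) \<le> m"
    unfolding derivation_relation[OF D] using coeff_derivation_const_top[OF D x, of h]
    by (intro degree_diff_le) auto
  show t: "degree (D ore_t) \<le> Suc m"
  proof (rule ccontr)
    assume "\<not> ?thesis"
    then obtain k where k: "degree (D ore_t) = Suc k" "m < k"
      by (metis Suc_less_eq2 not_le)
    then have "coeff (D ore_t) (Suc k) \<noteq> 0"
      by (metis leading_coeff_0_iff degree_0 nat.distinct(1))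
    moreover have "coeff (?R (D ore_t)) k = 0"
      using deg k by (simp add: coeff_eq_0)
    moreover have "of_nat (Suc k) \<noteq> (0 :: 'k poly)"
      using of_nat_neq_0 by blast
    ultimately show False
      using R[of "D ore_t" k] k h by (simp del: of_nat_Suc)
  qed
  have "coeff (?R (D ore_t)) m = h * pderiv A - A * pderiv h"
    unfolding derivation_relation[OF D] using coeff_derivation_const_top[OF D x, of h]
    by (simp add: coeff_map_poly A_def)
  then show "of_nat (Suc m) * h * coeff (D ore_t) (Suc m) = A * pderiv h - h * pderiv A"
    using R[OF t] by (simp del: of_nat_Suc add: algebra_simps)
qed

text \<open>
  By \<open>coeff_derivation_t_top\<close>, \<open>h\<close> divides the product of the top coefficient of \<open>D x\<close> with \<open>h'\<close>. This is
  where square-freeness enters.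
\<close>

lemma dvd_derivation_x_top:
  fixes h :: "'k::field_char_0 poly"
  assumes D: "ore_derivation h D" and h: "h \<noteq> 0" and cop: "coprime h (pderiv h)"
    and x: "degree (D ore_x) \<le> m"
  shows "h dvd coeff (D ore_x) m"
proof -
  have "coeff (D ore_x) m * pderiv h =
      h * (of_nat (Suc m) * coeff (D ore_t) (Suc m) + pderiv (coeff (D ore_x) m))"
    using coeff_derivation_t_top(2)[OF D h x] by (simp del: of_nat_Suc add: algebra_simps)
  then have "h dvd coeff (D ore_x) m * pderiv h"
    by simp
  then show ?thesis
    by (rule poly_coprime_dvd_multD[OF cop h])
qed

text \<open>
  Since \<open>ad\<^sub>t x = h\<close>, both sides agree at \<open>x\<close>. The only question is whether \<open>D t\<close> lies in
  \<open>\<k>[x]\<close>: for \<open>D x = c h\<close> the right-hand side \<open>A h' - h A'\<close> in \<open>coeff_derivation_t_top\<close>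
  vanishes, and with it the coefficient of \<open>D t\<close> at \<open>t\<close>.
\<close>

lemma derivation_with_x_multiple_of_h:
  fixes h :: "'k::field_char_0 poly"
  assumes D: "ore_derivation h D" and h: "h \<noteq> 0" and x: "D ore_x = [:smult c h:]"
  shows "\<exists>g. D = (\<lambda>a. ore_scale c (inner_derivation (ore_mult h) ore_t a) + ore_D h g a)"
proof -
  have "degree (D ore_x) \<le> 0"
    by (simp add: x)
  from coeff_derivation_t_top[OF D h this]
  have "degree (D ore_t) \<le> 1" "h * coeff (D ore_t) 1 = 0"
    by (simp_all add: x pderiv_smult algebra_simps)
  then have "degree (D ore_t) = 0"
    using h by (metis One_nat_def degree_0 le_SucE le_zero_eq leading_coeff_0_iff mult_eq_0_iff)
  then obtain g where g: "D ore_t = [:g:]"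
    using degree_eq_zeroE by auto
  have "D = (\<lambda>a. ore_scale c (inner_derivation (ore_mult h) ore_t a) + ore_D h g a)"
    by (rule ore_derivation_eqI[OF D ore_derivation_lincomb[OF ore_derivation_inner ore_D(1)]])
      (simp_all add: x g ore_D inner_derivation_t_x inner_derivation_self ore_scale_def)
  then show ?thesis ..
qed


section \<open>Growth of the orbit of \<open>x\<close>\<close>

text \<open>
  Write \<open>A = h v\<close> for the top coefficient of \<open>D x\<close>. By \<open>coeff_derivation_t_top\<close> the top
  coefficient \<open>B\<close> of \<open>D t\<close> satisfies \<open>(m + 1) B = - h v'\<close>, so up to the factor \<open>m + 1\<close> the
  top coefficient \<open>A f' + k B f\<close> of \<open>D (f t\<^sup>k + \<dots>)\<close> is \<open>h\<close> times a weighted Wronskian of \<open>v\<close>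
  and \<open>f\<close>. Hence each application of \<open>D\<close> adds \<open>m\<close> to the degree in \<open>t\<close> and
  \<open>deg h + deg v - 1\<close> to the degree in \<open>x\<close> of the top coefficient.
\<close>

lemma derivation_growth:
  fixes h :: "'k::field_char_0 poly"
  assumes D: "ore_derivation h D" and h: "degree h > 0" and cop: "coprime h (pderiv h)"
    and nz: "D ore_x \<noteq> 0"
  defines "m \<equiv> degree (D ore_x)" and "s \<equiv> degree (lead_coeff (D ore_x)) - 1"
  shows "degree ((D ^^ r) ore_x) = r * m \<and> degree (lead_coeff ((D ^^ r) ore_x)) = 1 + r * s"
proof -
  define A where "A = coeff (D ore_x) m"
  define B where "B = coeff (D ore_t) (Suc m)"
  have h0: "h \<noteq> 0" and A0: "A \<noteq> 0"
    using h nz by (auto simp: A_def m_def)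
  have x: "degree (D ore_x) \<le> m"
    by (simp add: m_def)
  note t = coeff_derivation_t_top[OF D h0 x, folded A_def B_def]
  have eq: "A * pderiv h = h * (of_nat (Suc m) * B + pderiv A)"
    using t(2) by (simp del: of_nat_Suc add: algebra_simps)
  have "h dvd A"
    unfolding A_def by (rule dvd_derivation_x_top[OF D h0 cop x])
  then obtain v where A: "A = h * v" ..
  have v0: "v \<noteq> 0"
    using A A0 by auto
  have s: "s = degree h + degree v - 1" "degree v \<le> s"
    using A h0 v0 h by (simp_all add: s_def A_def[symmetric, unfolded m_def] degree_mult_eq)
  \<comment> \<open>For \<open>A = h v\<close> the terms with \<open>h'\<close> in \<open>A h' - h A'\<close> cancel.\<close>
  have "h * (of_nat (Suc m) * B) = h * (- (h * pderiv v))"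
    using eq unfolding A pderiv_mult
    by (simp del: of_nat_Suc add: algebra_simps eq_neg_iff_add_eq_0)
  then have B: "of_nat (Suc m) * B = - (h * pderiv v)"
    using h0 mult_left_cancel by blast
  have Suc_m: "(of_nat (Suc m) :: 'k) \<noteq> 0"
    using of_nat_neq_0 by blast
  \<comment> \<open>The hypothesis on \<open>k\<close> and \<open>j\<close> makes the two parts of the top coefficient not cancel.\<close>
  have step: "degree (D a) = k + m \<and> degree (lead_coeff (D a)) = j + s"
    if a: "degree a = k" "degree (lead_coeff a) = j" and less: "k * degree v < Suc m * j" for a k j
  proof -
    define f where "f = coeff a k"
    define C where "C = coeff (D a) (k + m)"
    define w where "w = smult (of_nat (Suc m)) (v * pderiv f) - smult (of_nat k) (pderiv v * f)"
    have f: "f \<noteq> 0" "degree f = j"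
      using a less by (auto simp: f_def)
    have deg: "degree (D a) \<le> k + m" and C: "C = A * pderiv f + of_nat k * B * f"
      using coeff_derivation_top[OF D x t(1), of a k] a by (simp_all add: A_def B_def C_def f_def)
    have "smult (of_nat (Suc m)) C =
        smult (of_nat (Suc m)) (A * pderiv f) + of_nat k * (of_nat (Suc m) * B) * f"
      unfolding C smult_add_right by (simp del: of_nat_Suc add: of_nat_poly algebra_simps)
    also have "\<dots> = h * w"
      unfolding A B w_def by (simp del: of_nat_Suc add: of_nat_poly algebra_simps)
    finally have hw: "smult (of_nat (Suc m)) C = h * w" .
    have w: "w \<noteq> 0" "degree w = degree v + j - 1"
      using degree_weighted_wronskian[OF v0 f(1), of k "Suc m"] less f(2) unfolding w_def by auto
    have "j > 0"
      using less by (cases j) auto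
    have "C \<noteq> 0"
      using hw w h0 by auto
    moreover have "degree C = j + s"
      using arg_cong[OF hw, of degree] Suc_m h0 w h \<open>j > 0\<close> s
      by (simp del: of_nat_Suc add: degree_mult_eq)
    ultimately show ?thesis
      using deg le_degree[of "D a" "k + m"] unfolding C_def by simp
  qed
  show ?thesis
  proof (induction r)
    case 0
    show ?case by (simp add: ore_x_def)
  next
    case (Suc r)
    \<comment> \<open>The hypothesis of the step persists along the orbit because \<open>deg v \<le> s\<close>.\<close>
    have "r * m * degree v \<le> r * m * s"
      using s(2) by simp
    also have "\<dots> < Suc m * (1 + r * s)"
      by (simp add: algebra_simps)
    finally have less: "r * m * degree v < Suc m * (1 + r * s)" .
    have deg: "degree (D ((D ^^ r) ore_x)) = r * m + m \<and>
        degree (lead_coeff (D ((D ^^ r) ore_x))) = 1 + r * s + s"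
      by (rule step[OF conjunct1[OF Suc.IH] conjunct2[OF Suc.IH] less])
    have "degree ((D ^^ Suc r) ore_x) = Suc r * m"
      using conjunct1[OF deg] by simp
    moreover have "degree (lead_coeff ((D ^^ Suc r) ore_x)) = 1 + Suc r * s"
      using conjunct2[OF deg] by simp
    ultimately show ?case
      by (rule conjI)
  qed
qed


section \<open>Filtration by weight\<close>

text \<open>
  Elements of weight at most \<open>N\<close>, where \<open>x\<close> has weight \<open>1\<close> and \<open>t\<close> has weight \<open>e\<close>. The bound
  is an integer so that splitting off a factor \<open>t\<close> can subtract \<open>e\<close> from it; for negative
  bounds only \<open>0\<close> remains.
\<close>

definition weight_filtration :: "nat \<Rightarrow> int \<Rightarrow> 'k::field poly poly set"
  where "weight_filtration e N =
    {p. \<forall>i. coeff p i \<noteq> 0 \<longrightarrow> int (degree (coeff p i)) + int e * int i \<le> N}"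

lemma weight_filtration_0 [simp]: "0 \<in> weight_filtration e N"
  by (simp add: weight_filtration_def)

lemma weight_filtration_pCons:
  "pCons f p \<in> weight_filtration e N \<longleftrightarrow>
    (f \<noteq> 0 \<longrightarrow> int (degree f) \<le> N) \<and> p \<in> weight_filtration e (N - int e)"
proof -
  have all_nat: "(\<forall>i. P i) \<longleftrightarrow> P 0 \<and> (\<forall>i. P (Suc i))" for P
    by (metis not0_implies_Suc)
  show ?thesis
    unfolding weight_filtration_def mem_Collect_eq
    by (subst all_nat) (simp add: algebra_simps)
qed

lemma weight_filtration_add:
  assumes "p \<in> weight_filtration e N" "q \<in> weight_filtration e N"
  shows "p + q \<in> weight_filtration e N"
proof -
  have "int (degree (coeff p i + coeff q i)) + int e * int i \<le> N"
    if "coeff p i + coeff q i \<noteq> 0" for i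
    using assms that degree_add_le_max[of "coeff p i" "coeff q i"]
    by (cases "coeff p i = 0"; cases "coeff q i = 0")
      (fastforce simp: weight_filtration_def)+
  then show ?thesis
    by (simp add: weight_filtration_def)
qed

lemma weight_filtration_smult:
  assumes "p \<in> weight_filtration e N" and "int (degree f) \<le> M"
  shows "smult f p \<in> weight_filtration e (M + N)"
proof -
  have "int (degree (f * coeff p i)) + int e * int i \<le> M + N" if "f * coeff p i \<noteq> 0" for i
    using assms that degree_mult_le[of f "coeff p i"] by (fastforce simp: weight_filtration_def)
  then show ?thesis
    by (simp add: weight_filtration_def)
qed

lemma weight_filtration_mono:
  "p \<in> weight_filtration e M \<Longrightarrow> M \<le> N \<Longrightarrow> p \<in> weight_filtration e N"
  by (force simp: weight_filtration_def)

text \<open>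
  The correction term \<open>h f'\<close> in \<open>t f = f t + h f'\<close> has degree at most \<open>deg h + deg f - 1\<close>, so the
  hypothesis on \<open>h\<close> says that its weight does not exceed that of \<open>f t\<close>.
\<close>

lemma weight_filtration_tmult:
  assumes h: "degree h \<le> Suc e" and p: "p \<in> weight_filtration e N"
  shows "ore_tmult h p \<in> weight_filtration e (N + int e)"
proof -
  have "int (degree (h * pderiv (coeff p i))) + int e * int i \<le> N + int e"
    if "h * pderiv (coeff p i) \<noteq> 0" for i
  proof -
    have "degree (coeff p i) \<noteq> 0"
      using that by (metis degree_eq_zeroE mult_zero_right pderiv_singleton)
    then have "coeff p i \<noteq> 0" "degree (coeff p i) \<noteq> 0"
      by auto
    moreover have "degree (pderiv (coeff p i)) \<le> degree (coeff p i) - 1"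
      by (rule degree_le) (auto simp: coeff_pderiv coeff_eq_0)
    then have "degree (h * pderiv (coeff p i)) \<le> Suc e + (degree (coeff p i) - 1)"
      using degree_mult_le[of h "pderiv (coeff p i)"] h by linarith
    ultimately show ?thesis
      using p by (fastforce simp: weight_filtration_def)
  qed
  then have "map_poly (\<lambda>f. h * pderiv f) p \<in> weight_filtration e (N + int e)"
    by (simp add: weight_filtration_def coeff_map_poly)
  then show ?thesis
    using p unfolding ore_tmult_def by (intro weight_filtration_add) (simp_all add: weight_filtration_pCons)
qed

lemma weight_filtration_mult:
  assumes h: "degree h \<le> Suc e"
  shows "p \<in> weight_filtration e N \<Longrightarrow> q \<in> weight_filtration e M \<Longrightarrow>
    ore_mult h p q \<in> weight_filtration e (N + M)"
proof (induction p arbitrary: q N M)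
  case (pCons f p)
  have "smult f q \<in> weight_filtration e (N + M)"
    using pCons.prems by (cases "f = 0") (auto simp: weight_filtration_pCons intro: weight_filtration_smult)
  moreover have "ore_mult h p (ore_tmult h q) \<in> weight_filtration e (N - int e + (M + int e))"
    using pCons.prems
    by (intro pCons.IH weight_filtration_tmult[OF h]) (simp_all add: weight_filtration_pCons)
  ultimately show ?case
    by (auto simp: ore_mult_pCons intro: weight_filtration_add)
qed simp

text \<open>
  A derivation preserves a filtration of the algebra as soon as it does not raise the weight
  of the generators.
\<close>

lemma weight_filtration_derivation:
  assumes h: "degree h \<le> Suc e" and D: "ore_derivation h D"
    and x: "D ore_x \<in> weight_filtration e 1" and t: "D ore_t \<in> weight_filtration e (int e)"
    and p: "p \<in> weight_filtration e N"
  shows "D p \<in> weight_filtration e N"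
proof -
  have const: "D [:f:] \<in> weight_filtration e N" if "f \<noteq> 0 \<longrightarrow> int (degree f) \<le> N" for f N
    using that
  proof (induction f arbitrary: N)
    case (pCons c f)
    then have f: "f \<noteq> 0 \<longrightarrow> int (degree f) \<le> N - 1"
      by auto
    have "ore_mult h (D ore_x) [:f:] \<in> weight_filtration e (1 + (N - 1))"
      using f by (intro weight_filtration_mult[OF h x]) (simp add: weight_filtration_pCons)
    moreover have "smult [:0, 1:] (D [:f:]) \<in> weight_filtration e (1 + (N - 1))"
      using f by (intro weight_filtration_smult pCons.IH) simp_all
    ultimately show ?case
      by (auto simp: derivation_const_pCons[OF D] intro: weight_filtration_add)
  qed (simp add: derivation_0[OF D])
  from p show ?thesis
  proof (induction p arbitrary: N)
    case (pCons f p)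
    then have p: "p \<in> weight_filtration e (N - int e)"
      by (simp add: weight_filtration_pCons)
    have "ore_mult h p (D ore_t) \<in> weight_filtration e (N - int e + int e)"
      by (rule weight_filtration_mult[OF h p t])
    then show ?case
      using const[of f N] pCons.IH[OF p] pCons.prems
      unfolding derivation_pCons[OF D, of f p]
      by (intro weight_filtration_add) (simp_all add: weight_filtration_pCons)
  qed (simp add: derivation_0[OF D])
qed

interpretation ore: vector_space ore_scale
  by (rule vector_space_ore_scale)

lemma subspace_weight_filtration: "ore.subspace (weight_filtration e N)"
proof -
  have "ore_scale c p \<in> weight_filtration e N" if "p \<in> weight_filtration e N" for c p
    using weight_filtration_smult[OF that, of "[:c:]" 0] by (simp add: ore_scale_def)
  then show ?thesis
    by (auto simp: ore.subspace_def intro: weight_filtration_add)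
qed

lemma weight_filtration_exhaustive: "\<exists>N. p \<in> weight_filtration e N"
proof (induction p)
  case (pCons f p)
  from pCons.IH obtain N where "p \<in> weight_filtration e N" ..
  then have "pCons f p \<in> weight_filtration e (max (int (degree f)) (N + int e))"
    unfolding weight_filtration_pCons by (auto intro: weight_filtration_mono)
  then show ?case ..
qed (auto intro: exI[of _ 0])

lemma span_finite_subset_weight_filtration:
  assumes "finite B"
  shows "\<exists>N. ore.span B \<subseteq> weight_filtration e N"
proof -
  have "\<exists>N. B \<subseteq> weight_filtration e N"
    using assms
  proof (induction B rule: finite_induct)
    case (insert b B)
    then obtain M N where "B \<subseteq> weight_filtration e M" "b \<in> weight_filtration e N"
      using weight_filtration_exhaustive by metis
    then have "insert b B \<subseteq> weight_filtration e (max M N)"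
      by (auto intro: weight_filtration_mono)
    then show ?case ..
  qed simp
  then show ?thesis
    using ore.span_minimal[OF _ subspace_weight_filtration] by metis
qed

lemma weight_filtration_finite_dimensional:
  assumes "e > 0"
  shows "\<exists>B. finite B \<and> weight_filtration e N \<subseteq> ore.span B"
proof -
  define n where "n = nat N"
  let ?B = "(\<lambda>(i, j). monom (monom 1 j) i) ` ({..n} \<times> {..n})"
  have "p \<in> ore.span ?B" if p: "p \<in> weight_filtration e N" for p
  proof -
    have deg: "degree (coeff p i) + i \<le> n" if "coeff p i \<noteq> 0" for i
    proof -
      have "int (degree (coeff p i)) + int e * int i \<le> N"
        using p that by (simp add: weight_filtration_def)
      moreover have "int i \<le> int e * int i"
        using assms by (cases e) (simp_all add: algebra_simps)
      ultimately show ?thesis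
        unfolding n_def by linarith
    qed
    have coeffs: "degree (coeff p i) \<le> n" for i
      using deg[of i] by (cases "coeff p i = 0") auto
    have "degree p \<le> n"
      using deg[of "degree p"] by (cases "p = 0") auto
    then have "p = (\<Sum>i\<le>n. monom (coeff p i) i)"
      by (rule poly_as_sum_of_monoms'[symmetric])
    also have "\<dots> = (\<Sum>i\<le>n. monom (\<Sum>j\<le>n. monom (coeff (coeff p i) j) j) i)"
      by (simp add: poly_as_sum_of_monoms' coeffs)
    also have "\<dots> = (\<Sum>i\<le>n. \<Sum>j\<le>n. ore_scale (coeff (coeff p i) j) (monom (monom 1 j) i))"
      by (simp add: monom_sum ore_scale_def smult_monom)
    also have "\<dots> \<in> ore.span ?B"
      by (intro ore.span_sum ore.span_scale ore.span_base) auto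
    finally show ?thesis .
  qed
  then show ?thesis
    by (intro exI[of _ ?B]) auto
qed


section \<open>Locally finite and locally nilpotent derivations\<close>

text \<open>
  In the definition the finite set has to span the same space as the orbit. A
  maximal linearly independent part of the orbit does, once the orbit lies in some
  finite-dimensional space.
\<close>

lemma locally_finiteI:
  assumes "\<And>a. \<exists>B. finite B \<and> (\<forall>n. (D ^^ n) a \<in> ore.span B)"
  shows "locally_finite ore_scale D"
  unfolding locally_finite_def
proof
  fix a
  let ?S = "{(D ^^ n) a |n. True}"
  obtain B where B: "finite B" "\<forall>n. (D ^^ n) a \<in> ore.span B"
    using assms by blast
  obtain C where C: "C \<subseteq> ?S" "ore.independent C" "?S \<subseteq> ore.span C"
    by (rule ore.maximal_independent_subset)
  have "?S \<subseteq> ore.span B"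
    using B(2) by auto
  then have "C \<subseteq> ore.span B"
    using C(1) by (rule order.trans[rotated])
  then have "finite C"
    using ore.independent_span_bound[OF B(1) C(2)] by simp
  moreover have "?S \<subseteq> ore.span C" "C \<subseteq> ore.span ?S"
    using C(3) order.trans[OF C(1) ore.span_superset] by simp_all
  then have "ore.span ?S = ore.span C"
    unfolding ore.span_eq by (rule conjI)
  ultimately show "\<exists>B. finite B \<and> ore.span ?S = ore.span B"
    by (intro exI[of _ C] conjI)
qed

lemma locally_finite_if_locally_nilpotent:
  assumes D: "ore_derivation h D" and "locally_nilpotent D"
  shows "locally_finite ore_scale D"
proof (rule locally_finiteI)
  fix a
  obtain n where n: "(D ^^ n) a = 0"
    using assms(2) by (auto simp: locally_nilpotent_def)
  have 0: "(D ^^ (k + n)) a = 0" for k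
    by (induction k) (simp_all add: n derivation_0[OF D])
  let ?B = "(\<lambda>i. (D ^^ i) a) ` {..<n}"
  have "(D ^^ i) a \<in> ore.span ?B" for i
  proof (cases "i < n")
    case True
    then show ?thesis
      by (intro ore.span_base imageI) simp
  next
    case False
    then show ?thesis
      using 0[of "i - n"] by (simp add: ore.span_zero)
  qed
  moreover have "finite ?B"
    by simp
  ultimately show "\<exists>B. finite B \<and> (\<forall>i. (D ^^ i) a \<in> ore.span B)"
    by blast
qed

text \<open>
  \<open>D\<^sub>g\<close> lowers the degree in \<open>t\<close> and kills \<open>\<k>[x]\<close>.
\<close>

lemma locally_nilpotent_ore_D: "locally_nilpotent (ore_D h g)"
proof -
  note D = ore_D[of h g]
  have "(ore_D h g ^^ Suc k) p = 0" if "degree p \<le> k" for k p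
    using that
  proof (induction k arbitrary: p)
    case 0
    then obtain f where "p = [:f:]"
      using degree_eq_zeroE by auto
    then show ?case
      by (simp add: derivation_const_0[OF D(1,2)])
  next
    case (Suc k)
    then show ?case
      using Suc.IH[of "ore_D h g p"] coeff_x_killing_derivation_top[OF D Suc.prems]
      by (simp only: funpow_Suc_right o_apply)
  qed
  then show ?thesis
    unfolding locally_nilpotent_def by (intro allI exI[of _ "Suc (degree _)"]) auto
qed

text \<open>
  Here \<open>deg h = 1\<close> makes \<open>D x = c h\<close> have weight at most \<open>1\<close>, the weight of \<open>x\<close>.
\<close>

lemma locally_finite_if_degree_1:
  assumes h: "degree h = 1" and D: "ore_derivation h D"
    and x: "D ore_x = [:smult c h:]" and t: "D ore_t = [:g:]"
  shows "locally_finite ore_scale D"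
proof (rule locally_finiteI)
  fix a :: "'a poly poly"
  \<comment> \<open>The weight of \<open>t\<close> must be at least \<open>deg g\<close> for \<open>D\<close> to preserve the filtration, and
    positive for its pieces to be finite-dimensional.\<close>
  define e where "e = Suc (degree g)"
  obtain N where a: "a \<in> weight_filtration e N"
    using weight_filtration_exhaustive by blast
  have "(D ^^ n) a \<in> weight_filtration e N" for n
  proof (induction n)
    case (Suc n)
    then show ?case
      using weight_filtration_derivation[OF _ D, of e] h degree_smult_le[of c h]
      by (simp add: x t weight_filtration_pCons e_def)
  qed (simp add: a)
  moreover obtain B :: "'a poly poly set" where "finite B" "weight_filtration e N \<subseteq> ore.span B"
    using weight_filtration_finite_dimensional[of e N] unfolding e_def by blast
  ultimately show "\<exists>B. finite B \<and> (\<forall>n. (D ^^ n) a \<in> ore.span B)"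
    by blast
qed

text \<open>
  Otherwise the orbit of \<open>x\<close> would have unbounded degree in \<open>t\<close> or in \<open>x\<close> by
  \<open>derivation_growth\<close>, whereas a finite-dimensional space lies in a single piece of the
  weight filtration.
\<close>

lemma locally_finite_bounded_degrees:
  fixes h :: "'k::field_char_0 poly"
  assumes D: "ore_derivation h D" and h: "degree h > 0" and cop: "coprime h (pderiv h)"
    and lf: "locally_finite ore_scale D" and nz: "D ore_x \<noteq> 0"
  shows "degree (D ore_x) = 0" "degree (lead_coeff (D ore_x)) \<le> 1"
proof -
  define m s where "m = degree (D ore_x)" and "s = degree (lead_coeff (D ore_x)) - 1"
  obtain B where B: "finite B" "ore.span {(D ^^ n) ore_x |n. True} = ore.span B"
    using lf unfolding locally_finite_def by blast
  obtain N where N: "ore.span B \<subseteq> weight_filtration 1 N"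
    using span_finite_subset_weight_filtration[OF B(1)] by blast
  \<comment> \<open>With both variables of weight one, the \<open>r\<close>-th iterate has weight at least
    \<open>1 + r (m + s)\<close>.\<close>
  have bound: "int (1 + r * (m + s)) \<le> N" for r
  proof -
    let ?a = "(D ^^ r) ore_x"
    have a: "degree ?a = r * m" "degree (lead_coeff ?a) = 1 + r * s"
      using derivation_growth[OF D h cop nz, of r] unfolding m_def s_def by blast+
    then have "lead_coeff ?a \<noteq> 0"
      by auto
    moreover have "?a \<in> ore.span {(D ^^ n) ore_x |n. True}"
      by (rule ore.span_base) auto
    then have "?a \<in> weight_filtration 1 N"
      using N B(2) by auto
    ultimately have "int (degree (lead_coeff ?a)) + int (degree ?a) \<le> N"
      by (simp add: weight_filtration_def)
    then have "int (1 + r * s) + int (degree ?a) \<le> N"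
      by (simp only: a(2))
    then show ?thesis
      by (simp add: a(1) algebra_simps)
  qed
  have "m + s = 0"
  proof (rule ccontr)
    assume "m + s \<noteq> 0"
    then have "nat N * 1 \<le> nat N * (m + s)"
      by (intro mult_le_mono) auto
    then show False
      using bound[of "nat N"] by linarith
  qed
  then show "degree (D ore_x) = 0" "degree (lead_coeff (D ore_x)) \<le> 1"
    by (auto simp: m_def s_def)
qed

text \<open>
  When \<open>D x \<noteq> 0\<close>, it lies in \<open>\<k>[x]\<close>, is divisible by \<open>h\<close> and has degree at most one, which
  leaves room for nonconstant \<open>h\<close> only if \<open>deg h = 1\<close>.
\<close>

lemma locally_finite_derivation_x:
  fixes h :: "'k::field_char_0 poly"
  assumes D: "ore_derivation h D" and h: "degree h > 0" and cop: "coprime h (pderiv h)"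
    and lf: "locally_finite ore_scale D"
  obtains c where "D ore_x = [:smult c h:]" "c \<noteq> 0 \<longrightarrow> degree h = 1"
proof (cases "D ore_x = 0")
  case True
  then show ?thesis
    using that[of 0] by simp
next
  case False
  have h0: "h \<noteq> 0"
    using h by auto
  obtain A where A: "D ore_x = [:A:]"
    using locally_finite_bounded_degrees(1)[OF D h cop lf False] degree_eq_zeroE by blast
  have "degree A \<le> 1" "A \<noteq> 0"
    using locally_finite_bounded_degrees(2)[OF D h cop lf False] False by (simp_all add: A)
  moreover have "h dvd A"
    using dvd_derivation_x_top[OF D h0 cop, of 0] by (simp add: A)
  then obtain v where v: "A = h * v" ..
  ultimately have "degree h + degree v \<le> 1"
    by (auto simp: degree_mult_eq h0)
  then have "degree h = 1" "degree v = 0"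
    using h by auto
  then obtain c where "v = [:c:]"
    using degree_eq_zeroE by blast
  then show ?thesis
    using that[of c] A v \<open>degree h = 1\<close> by simp
qed

theorem theorem17:
  fixes h :: "'k::{alg_closed_field, field_char_0} poly"
  assumes nonconst: "degree h > 0"
    and squarefree: "coprime h (pderiv h)"
  shows
    "(degree h \<ge> 2 \<longrightarrow>
       (\<forall>D. ore_derivation h D \<longrightarrow>
          (locally_finite ore_scale D \<longleftrightarrow> (\<exists>g. D = ore_D h g))) \<and>
       (\<forall>D. ore_derivation h D \<longrightarrow>
          (locally_finite ore_scale D \<longleftrightarrow> locally_nilpotent D))) \<and>
     (degree h = 1 \<longrightarrow>
       (\<forall>D. ore_derivation h D \<longrightarrow>
          (locally_finite ore_scale D \<longleftrightarrow>
             (\<exists>c g. D = (\<lambda>a. ore_scale c (inner_derivation (ore_mult h) ore_t a) + ore_D h g a)))))"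
proof -
  let ?E = "\<lambda>c g a. ore_scale c (inner_derivation (ore_mult h) ore_t a) + ore_D h g a"
  have h: "h \<noteq> 0"
    using nonconst by auto
  have form: "\<exists>c g. D = ?E c g \<and> (c \<noteq> 0 \<longrightarrow> degree h = 1)"
    if D: "ore_derivation h D" and lf: "locally_finite ore_scale D" for D
  proof -
    obtain c where "D ore_x = [:smult c h:]" and c: "c \<noteq> 0 \<longrightarrow> degree h = 1"
      using locally_finite_derivation_x[OF D nonconst squarefree lf] .
    then obtain g where "D = ?E c g"
      using derivation_with_x_multiple_of_h[OF D h] by blast
    with c show ?thesis
      by blast
  qed
  have locally_finite_D: "locally_finite ore_scale (ore_D h g)" for g
    by (rule locally_finite_if_locally_nilpotent[OF ore_D(1) locally_nilpotent_ore_D])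
  have E_0: "?E 0 g = ore_D h g" for g
    by (simp add: ore_scale_def)
  show ?thesis
  proof (intro conjI impI allI)
    fix D assume "2 \<le> degree h" and D: "ore_derivation h D"
    have only_D: "\<exists>g. D = ore_D h g" if lf: "locally_finite ore_scale D"
    proof -
      obtain c g where "D = ?E c g" and "c \<noteq> 0 \<longrightarrow> degree h = 1"
        using form[OF D lf] by blast
      moreover from this have "c = 0"
        using \<open>2 \<le> degree h\<close> by auto
      ultimately show ?thesis
        using E_0 by blast
    qed
    then show "locally_finite ore_scale D \<longleftrightarrow> (\<exists>g. D = ore_D h g)"
      using locally_finite_D by blast
    show "locally_finite ore_scale D \<longleftrightarrow> locally_nilpotent D"
      using only_D locally_nilpotent_ore_D locally_finite_if_locally_nilpotent[OF D] by blast
  next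
    fix D assume deg: "degree h = 1" and D: "ore_derivation h D"
    have E: "ore_derivation h (?E c g)" for c g
      by (rule ore_derivation_lincomb[OF ore_derivation_inner ore_D(1)])
    have "locally_finite ore_scale (?E c g)" for c g
      by (rule locally_finite_if_degree_1[OF deg E, where c = c and g = g])
        (simp_all add: ore_D inner_derivation_t_x inner_derivation_self ore_scale_def)
    then show "locally_finite ore_scale D \<longleftrightarrow> (\<exists>c g. D = ?E c g)"
      using form[OF D] by blast
  qed
qed

end
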